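(* Let $f(x)=g(Ex)$ for $x\in\mathbb{R}^n$, where $E\in\mathbb{R}^{m\times n}$ and $g:\mathbb{R}^m\to\mathbb{R}$ is continuously differentiable and strictly convex on $\mathbb{R}^m$, with $\|\nabla g(u)-\nabla g(v)\|_2\le L\|u-v\|_2$ for all $u,v\in\mathbb{R}^m$ and some $L>0$. Assume that the set $\mathcal{X}$ of minimizers of $f$ over $\mathbb{R}^n$ is non-empty, and let $t^*\in\mathbb{R}^m$ be the common value of $Ex^*$ over $x^*\in\mathcal{X}$. For some $B>0$ let $\mathcal{S}_B=\{y\in\mathbb{R}^m:\|y-t^*\|_2\le B\}$, and suppose that $g$ is strongly convex on $\mathcal{S}_B$, i.e., there is $\sigma_B>0$ such that $$g(y)-g(z)\ge (y-z)^T\nabla g(z)+\sigma_B\|y-z\|_2^2\quad\text{for all } y,z\in\mathcal{S}_B.$$ Then there exists $\tau_B>0$ such that $$\mathrm{dist}(x,\mathcal{X})\le \tau_B\|\nabla f(x)\|_2$$ for all $x\in\mathbb{R}^n$ satisfying $Ex\in\mathcal{S}_B$.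
   Context: The map $x\mapsto Ex$ is constant on $\mathcal{X}$ (because $g$ is strictly convex), so $t^*$ is well defined. $\mathrm{dist}(x,\mathcal{X})=\min_{y\in\mathcal{X}}\|x-y\|_2$, with $\|\cdot\|_2$ the Euclidean norm. *)

theory Defs
  imports "HOL-Analysis.Analysis"
begin

text \<open>The value is only meaningful where \<open>f\<close> is differentiable.\<close>

definition gradient :: "('a::real_inner \<Rightarrow> real) \<Rightarrow> 'a \<Rightarrow> 'a"
  where "gradient f x = (THE D. GDERIV f x :> D)"

lemma gradient_eqI:
  assumes "GDERIV f x :> D"
  shows "gradient f x = D"
  unfolding gradient_def
proof (rule the_equality)
  show "GDERIV f x :> D" by (rule assms)
next
  fix D' assume "GDERIV f x :> D'"
  then have "(\<lambda>h. inner h D') = (\<lambda>h. inner h D)"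
    using assms unfolding gderiv_def by (rule has_derivative_unique)
  then have "inner (D' - D) D' = inner (D' - D) D"
    by (rule fun_cong)
  then have "inner (D' - D) (D' - D) = 0"
    by (simp only: inner_diff_right)
  then show "D' = D"
    by simp
qed

lemma GDERIV_gradient:
  fixes f :: "'a::euclidean_space \<Rightarrow> real"
  assumes "f differentiable (at x)"
  shows "GDERIV f x :> gradient f x"
proof -
  obtain f' where f': "(f has_derivative f') (at x)"
    using assms by (auto simp: differentiable_def)
  interpret f': bounded_linear f'
    using f' by (rule has_derivative_bounded_linear)
  let ?D = "adjoint f' 1"
  have "f' h = inner h ?D" for h
    using adjoint_works[OF f'.linear_axioms, of h 1] by (simp add: inner_commute)
  then have "f' = (\<lambda>h. inner h ?D)"
    by (rule ext)
  with f' have "GDERIV f x :> ?D"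
    by (simp add: gderiv_def)
  with gradient_eqI[OF this] show ?thesis
    by simp
qed

definition strictly_convex_on :: "'a::real_vector set \<Rightarrow> ('a \<Rightarrow> real) \<Rightarrow> bool"
  where "strictly_convex_on S f \<longleftrightarrow> convex S \<and>
    (\<forall>x\<in>S. \<forall>y\<in>S. x \<noteq> y \<longrightarrow> (\<forall>u>0. \<forall>v>0. u + v = 1 \<longrightarrow>
       f (u *\<^sub>R x + v *\<^sub>R y) < u * f x + v * f y))"

definition minimizers :: "('a \<Rightarrow> real) \<Rightarrow> 'a set"
  where "minimizers f = {x. is_arg_min f (\<lambda>_. True) x}"

text \<open>
  The common value of \<open>h\<close> on \<open>A\<close>; only meaningful if \<open>A\<close> is non-empty and
  \<open>h\<close> is constant on \<open>A\<close>.
\<close>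

definition common_value :: "('a \<Rightarrow> 'b) \<Rightarrow> 'a set \<Rightarrow> 'b"
  where "common_value h A = (THE t. h ` A = {t})"

lemma common_value_minimizers:
  fixes E :: "real ^ 'n ^ 'm" and g :: "real ^ 'm \<Rightarrow> real"
  assumes g: "strictly_convex_on UNIV g"
    and x: "x \<in> minimizers (\<lambda>x. g (E *v x))"
  shows "common_value (\<lambda>x. E *v x) (minimizers (\<lambda>x. g (E *v x))) = E *v x"
proof -
  let ?X = "minimizers (\<lambda>x. g (E *v x))"
  have "E *v y = E *v x" if y: "y \<in> ?X" for y
  proof (rule ccontr)
    assume ne: "E *v y \<noteq> E *v x"
    have le: "g (E *v x) \<le> g (E *v z)" "g (E *v y) \<le> g (E *v z)" for z
      using x y by (auto simp: minimizers_def is_arg_min_linorder)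
    let ?z = "(1/2) *\<^sub>R y + (1/2) *\<^sub>R x"
    have "E *v ?z = (1/2) *\<^sub>R (E *v y) + (1/2) *\<^sub>R (E *v x)"
      by (simp add: matrix_vector_right_distrib matrix_vector_mult_scaleR)
    moreover have "g ((1/2) *\<^sub>R (E *v y) + (1/2) *\<^sub>R (E *v x))
        < (1/2) * g (E *v y) + (1/2) * g (E *v x)"
      using g[unfolded strictly_convex_on_def, THEN conjunct2, rule_format,
        OF UNIV_I UNIV_I ne, of "1/2" "1/2"] by simp
    ultimately show False
      using le(1)[of ?z] le(2)[of ?z] by simp
  qed
  then have "(\<lambda>x. E *v x) ` ?X = {E *v x}"
    using x by blast
  then show ?thesis
    by (simp add: common_value_def)
qed

end

theory Submission
  imports Defs
begin

text \<open>
  Take \<open>G\<close> linear with \<open>E (G v) = v\<close> on the range of \<open>E\<close>, and \<open>x\<^sub>0 \<in> X\<close>. The vector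
  \<open>p = G (E (x - x\<^sub>0))\<close> satisfies \<open>E p = E x - t\<close>, so \<open>x - p\<close> is again a minimizer and
  \<open>dist(x, X) \<le> \<parallel>p\<parallel> \<le> c \<parallel>E x - t\<parallel>\<close>. Strong convexity between \<open>t\<close> and \<open>E x\<close>, together with
  the minimality of \<open>g t\<close>, gives
  \<open>\<sigma> \<parallel>E x - t\<parallel>\<^sup>2 \<le> (E p) \<bullet> \<nabla>g (E x) = p \<bullet> \<nabla>f x \<le> c \<parallel>E x - t\<parallel> \<parallel>\<nabla>f x\<parallel>\<close>.
\<close>

lemma GDERIV_compose_matrix:
  fixes E :: "real ^ 'n ^ 'm" and g :: "real ^ 'm \<Rightarrow> real"
  assumes "GDERIV g (E *v x) :> D"
  shows "GDERIV (\<lambda>x. g (E *v x)) x :> D v* E"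
proof -
  have "((\<lambda>x. E *v x) has_derivative (\<lambda>h. E *v h)) (at x)"
    by (intro bounded_linear_imp_has_derivative matrix_vector_mul_bounded_linear)
  from has_derivative_compose[OF this assms[unfolded gderiv_def]]
  show ?thesis
    by (simp add: gderiv_def inner_commute[of _ D] inner_commute[of _ "D v* E"] dot_lmul_matrix)
qed

text \<open>A right inverse of \<open>T\<close> on its range can be chosen linear, hence bounded in
  finite dimension; its bound is a \<open>c\<close> that works for all \<open>x\<close>.\<close>

lemma linear_bounded_preimage:
  fixes T :: "'a::euclidean_space \<Rightarrow> 'b::euclidean_space"
  assumes "linear T"
  obtains c where "c > 0" and "\<And>x. \<exists>p. T p = T x \<and> norm p \<le> c * norm (T x)"
proof -
  obtain G where G: "linear G" "\<And>v. v \<in> range T \<Longrightarrow> T (G v) = v"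
    using linear_exists_right_inverse_on[OF assms subspace_UNIV] by auto
  obtain c where "c > 0" "\<And>v. norm (G v) \<le> c * norm v"
    using linear_bounded_pos[OF G(1)] by blast
  with G(2) show ?thesis
    by (intro that[of c]) auto
qed

theorem theorem1:
  fixes E :: "real ^ 'n ^ 'm"
    and g :: "real ^ 'm \<Rightarrow> real"
    and f :: "real ^ 'n \<Rightarrow> real"
    and X :: "(real ^ 'n) set"
    and t :: "real ^ 'm"
    and S :: "(real ^ 'm) set"
    and L B \<sigma> :: real
  assumes f_eq: "f = (\<lambda>x. g (E *v x))"
    and g_diff: "\<And>u. g differentiable (at u)"
    and g_C1: "continuous_on UNIV (gradient g)"
    and g_strict: "strictly_convex_on UNIV g"
    and L_pos: "L > 0"
    and g_lipschitz: "\<And>u v. norm (gradient g u - gradient g v) \<le> L * norm (u - v)"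
    and X_eq: "X = minimizers f"
    and X_nonempty: "X \<noteq> {}"
    and t_eq: "t = common_value (\<lambda>x. E *v x) X"
    and B_pos: "B > 0"
    and S_eq: "S = {y. norm (y - t) \<le> B}"
    and \<sigma>_pos: "\<sigma> > 0"
    and g_strong: "\<And>y z. y \<in> S \<Longrightarrow> z \<in> S \<Longrightarrow>
      g y - g z \<ge> (y - z) \<bullet> gradient g z + \<sigma> * (norm (y - z))\<^sup>2"
  shows "\<exists>\<tau>>0. \<forall>x. E *v x \<in> S \<longrightarrow> infdist x X \<le> \<tau> * norm (gradient f x)"
proof -
  obtain c where c: "c > 0" "\<And>x. \<exists>p. E *v p = E *v x \<and> norm p \<le> c * norm (E *v x)"
    using linear_bounded_preimage[OF matrix_vector_mul_linear[of E]] by blast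
  obtain x0 where x0: "x0 \<in> X"
    using X_nonempty by blast
  have t: "E *v x0 = t"
    using x0 unfolding t_eq X_eq f_eq by (intro common_value_minimizers[OF g_strict, symmetric])
  have min: "g t \<le> g (E *v z)" for z
    using x0 t by (auto simp: X_eq f_eq minimizers_def is_arg_min_linorder)
  \<comment> \<open>One factor \<open>c\<close> comes from the distance bound, the other from
    Cauchy-Schwarz.\<close>
  have "infdist x X \<le> c\<^sup>2 / \<sigma> * norm (gradient f x)" if x: "E *v x \<in> S" for x
  proof -
    let ?d = "norm (E *v x - t)" and ?D = "gradient g (E *v x)"
    obtain p where p: "E *v p = E *v x - t" "norm p \<le> c * ?d"
      using c(2)[of "x - x0"] t by (auto simp: matrix_vector_mult_diff_distrib)
    have "E *v (x - p) = t"
      by (simp add: matrix_vector_mult_diff_distrib p(1))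
    with min have "x - p \<in> X"
      by (simp add: X_eq f_eq minimizers_def is_arg_min_linorder)
    then have "infdist x X \<le> norm p"
      using infdist_le[of "x - p" X x] by (simp add: dist_norm)
    then have dist: "infdist x X \<le> c * ?d"
      using p(2) by linarith
    have grad: "gradient f x = ?D v* E"
      unfolding f_eq by (intro gradient_eqI GDERIV_compose_matrix GDERIV_gradient g_diff)
    have "t \<in> S"
      using B_pos by (simp add: S_eq)
    \<comment> \<open>The base point is \<open>E *v x\<close>, so the gradient that appears is the
      one in \<open>grad\<close>; \<open>g t - g (E *v x)\<close> is at most 0 and drops
      out.\<close>
    from g_strong[OF this x] min[of x] have "\<sigma> * ?d\<^sup>2 \<le> (E *v x - t) \<bullet> ?D"
      by (simp add: inner_diff_left norm_minus_commute)
    also have "\<dots> = p \<bullet> gradient f x"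
      by (simp add: grad inner_commute[of p] dot_lmul_matrix p(1) inner_commute[of ?D])
    also have "\<dots> \<le> norm p * norm (gradient f x)"
      by (rule norm_cauchy_schwarz)
    also have "\<dots> \<le> c * ?d * norm (gradient f x)"
      by (rule mult_right_mono[OF p(2)]) simp
    finally have "?d * (\<sigma> * ?d) \<le> ?d * (c * norm (gradient f x))"
      by (simp add: power2_eq_square ac_simps)
    \<comment> \<open>Cancel \<open>?d\<close> if positive; if it is 0, the left side
      vanishes.\<close>
    then have "\<sigma> * ?d \<le> c * norm (gradient f x)"
      using c(1) by (cases "?d = 0") (simp_all add: mult_le_cancel_left)
    then have "?d \<le> c * norm (gradient f x) / \<sigma>"
      using \<sigma>_pos by (simp add: field_simps)
    then have "c * ?d \<le> c * (c * norm (gradient f x) / \<sigma>)"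
      using c(1) by (intro mult_left_mono) auto
    with dist show ?thesis
      by (simp add: power2_eq_square)
  qed
  moreover have "c\<^sup>2 / \<sigma> > 0"
    using c(1) \<sigma>_pos by simp
  ultimately show ?thesis
    by blast
qed

end
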